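(* $R(K_4, K_4-e, K_4-e) \ge 35$. Equivalently, there exists a $3$-coloring of the edges of $K_{34}$ with colors $1,2,3$ that contains no copy of $K_4$ all of whose edges have color $1$, no copy of $K_4-e$ all of whose edges have color $2$, and no copy of $K_4-e$ all of whose edges have color $3$.
   Context: For graphs $G_1,\dots,G_k$, the multicolor Ramsey number $R(G_1,\dots,G_k)$ is the smallest $n$ such that every $k$-coloring of the edges of the complete graph $K_n$ (with colors $1,\dots,k$) contains, for some $i$, a copy of $G_i$ (as a not necessarily induced subgraph) all of whose edges have color $i$. $K_4-e$ denotes the graph obtained from $K_4$ by deleting one edge. *)

theory Defs
  imports "HOL-Library.Ramsey"
begin

text \<open>A graph is a pair of its vertex set and its set of edges, the edges being two-element
  sets of vertices; \<open>[V]\<^bsup>2\<^esup>\<close> is the set of all two-element subsets of \<open>V\<close>.\<close>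

type_synonym 'a ugraph = "'a set \<times> 'a set set"

abbreviation verts :: "'a ugraph \<Rightarrow> 'a set" where "verts \<equiv> fst"
abbreviation edges :: "'a ugraph \<Rightarrow> 'a set set" where "edges \<equiv> snd"

definition complete_graph :: "nat \<Rightarrow> nat ugraph" where
  "complete_graph n = ({..<n}, [{..<n}]\<^bsup>2\<^esup>)"

definition delete_edge :: "'a ugraph \<Rightarrow> 'a set \<Rightarrow> 'a ugraph" where
  "delete_edge G e = (verts G, edges G - {e})"

definition K4_minus_e :: "nat ugraph" where
  "K4_minus_e = delete_edge (complete_graph 4) {0, 1}"

text \<open>Copies are not required to be induced.\<close>

definition has_copy :: "'a ugraph \<Rightarrow> 'b ugraph \<Rightarrow> bool" where
  "has_copy G H \<longleftrightarrow>
     (\<exists>f. inj_on f (verts G) \<and> f ` verts G \<subseteq> verts H \<and> (\<forall>e\<in>edges G. f ` e \<in> edges H))"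

definition edge_colorings :: "nat \<Rightarrow> 'a ugraph \<Rightarrow> ('a set \<Rightarrow> nat) set" where
  "edge_colorings k G = edges G \<rightarrow> {1..k}"

definition color_class :: "'a ugraph \<Rightarrow> ('a set \<Rightarrow> nat) \<Rightarrow> nat \<Rightarrow> 'a ugraph" where
  "color_class G c i = (verts G, {e \<in> edges G. c e = i})"

text \<open>Colors are numbered from 1 and list positions from 0, so color \<open>i\<close> belongs to
  \<open>Gs ! (i - 1)\<close>. For finite graphs the least element exists by Ramsey's theorem.\<close>

definition ramsey_number :: "'a ugraph list \<Rightarrow> nat" where
  "ramsey_number Gs =
     (LEAST n. \<forall>c \<in> edge_colorings (length Gs) (complete_graph n).
        \<exists>i \<in> {1..length Gs}. has_copy (Gs ! (i - 1)) (color_class (complete_graph n) c i))"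

end

theory Submission
  imports Defs
begin

text \<open>
  The colouring is invariant under a cyclic group of order 8 that acts regularly on each of the
  blocks \<open>0-7\<close>, \<open>8-15\<close>, \<open>16-23\<close>, \<open>24-31\<close> and interchanges the vertices 32 and 33; it was found
  by simulated annealing among the colourings with this symmetry. A graph contains \<open>K\<^sub>4 - e\<close> iff
  the ends of some edge have two common neighbours, so it suffices to intersect rows of the
  adjacency matrices of the three colour classes. Ramsey's theorem is needed for the lower bound
  on the Ramsey number, as that number is a \<^const>\<open>Least\<close>, which means nothing if no suitable
  number exists.
\<close>

section \<open>Colourings as lower bounds for Ramsey numbers\<close>

text \<open>A colouring is a function on all sets of naturals, so one \<open>c\<close> colours every
  complete graph, and the embedding \<open>f\<close> serves unchanged in the larger one.\<close>

lemma has_copy_color_class_mono: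
  assumes "has_copy G (color_class (complete_graph n) c i)" and "n \<le> m"
  shows "has_copy G (color_class (complete_graph m) c i)"
proof -
  have sub: "{..<n} \<subseteq> {..<m}"
    using assms(2) by auto
  obtain f where "inj_on f (verts G)" and "f ` verts G \<subseteq> {..<n}"
    and edge: "\<And>e. e \<in> edges G \<Longrightarrow> f ` e \<in> [{..<n}]\<^bsup>2\<^esup> \<and> c (f ` e) = i"
    using assms(1) unfolding has_copy_def color_class_def complete_graph_def by auto
  moreover have "f ` verts G \<subseteq> {..<m}"
    using \<open>f ` verts G \<subseteq> {..<n}\<close> sub by (rule subset_trans)
  moreover have "f ` e \<in> [{..<m}]\<^bsup>2\<^esup>" if "e \<in> edges G" for e
    using edge[OF that] nsets_mono[OF sub] by (meson subsetD)
  ultimately show ?thesis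
    unfolding has_copy_def color_class_def complete_graph_def by (intro exI[of _ f]) simp
qed

lemma edge_colorings_complete_graph_antimono:
  assumes "c \<in> edge_colorings k (complete_graph m)" and "n \<le> m"
  shows "c \<in> edge_colorings k (complete_graph n)"
proof -
  have "[{..<n}]\<^bsup>2\<^esup> \<subseteq> [{..<m}]\<^bsup>2\<^esup>"
    using assms(2) by (intro nsets_mono) auto
  then show ?thesis
    using assms by (auto simp: edge_colorings_def complete_graph_def)
qed

text \<open>Reduction to cliques: Ramsey's theorem for the orders of the graphs yields a
  monochromatic set \<open>H\<close> with as many vertices as some \<open>Gs ! i\<close>, and any
  bijection onto \<open>H\<close> is then a copy, all pairs inside \<open>H\<close> having one
  colour.\<close>

lemma ex_ramsey_graphs:
  fixes Gs :: "'a ugraph list"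
  assumes "\<And>G. G \<in> set Gs \<Longrightarrow> finite (verts G)"
    and "\<And>G. G \<in> set Gs \<Longrightarrow> edges G \<subseteq> [verts G]\<^bsup>2\<^esup>"
  shows "\<exists>n. \<forall>c \<in> edge_colorings (length Gs) (complete_graph n).
    \<exists>i \<in> {1..length Gs}. has_copy (Gs ! (i - 1)) (color_class (complete_graph n) c i)"
proof -
  obtain n :: nat where n: "partn_lst {..<n} (map (\<lambda>G. card (verts G)) Gs) 2"
    using ramsey_full by blast
  have "\<exists>i \<in> {1..length Gs}. has_copy (Gs ! (i - 1)) (color_class (complete_graph n) c i)"
    if c: "c \<in> edge_colorings (length Gs) (complete_graph n)" for c
  proof -
    have range: "c e \<in> {1..length Gs}" if "e \<in> [{..<n}]\<^bsup>2\<^esup>" for e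
      using c that by (auto simp: edge_colorings_def complete_graph_def)
    \<comment> \<open>\<open>partn_lst\<close> numbers colours from 0, hence the shift.\<close>
    have "(\<lambda>e. c e - 1) \<in> [{..<n}]\<^bsup>2\<^esup> \<rightarrow> {..<length (map (\<lambda>G. card (verts G)) Gs)}"
      using range by fastforce
    then obtain i where i: "i < length Gs"
      and "monochromatic {..<n} (card (verts (Gs ! i))) 2 (\<lambda>e. c e - 1) i"
      using n unfolding partn_lst_def by fastforce
    then obtain H where H: "H \<in> [{..<n}]\<^bsup>card (verts (Gs ! i))\<^esup>"
      and mono: "(\<lambda>e. c e - 1) ` [H]\<^bsup>2\<^esup> \<subseteq> {i}"
      unfolding monochromatic_def by blast
    have H_sub: "H \<subseteq> {..<n}" and "finite H" and "card H = card (verts (Gs ! i))"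
      using H by (auto simp: nsets_def)
    then obtain f where f: "bij_betw f (verts (Gs ! i)) H"
      using assms(1)[OF nth_mem[OF i]] finite_same_card_bij by metis
    have "f ` e \<in> [{..<n}]\<^bsup>2\<^esup> \<and> c (f ` e) = Suc i" if "e \<in> edges (Gs ! i)" for e
    proof -
      have e: "e \<in> [verts (Gs ! i)]\<^bsup>2\<^esup>"
        using assms(2)[OF nth_mem[OF i]] that by blast
      have "inj_on f e"
        using f e by (auto simp: nsets_def bij_betw_def intro: inj_on_subset)
      then have fe: "f ` e \<in> [H]\<^bsup>2\<^esup>"
        using f e by (auto simp: nsets_def bij_betw_def card_image)
      then have "f ` e \<in> [{..<n}]\<^bsup>2\<^esup>"
        using nsets_mono[OF H_sub] by blast
      moreover have "c (f ` e) - 1 = i"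
        using mono fe by blast
      ultimately show ?thesis
        using range by fastforce
    qed
    then have "has_copy (Gs ! i) (color_class (complete_graph n) c (Suc i))"
      using f H_sub unfolding has_copy_def color_class_def complete_graph_def
      by (intro exI[of _ f]) (auto simp: bij_betw_def)
    then show ?thesis
      using i by (intro bexI[of _ "Suc i"]) auto
  qed
  then show ?thesis by blast
qed

text \<open>If the Ramsey number were at most \<open>m\<close>, then \<open>c\<close>, restricted to
  that many vertices, would contain a copy, and the copy would persist on \<open>m\<close>
  vertices.\<close>

lemma ramsey_number_gt:
  fixes Gs :: "'a ugraph list"
  assumes "\<And>G. G \<in> set Gs \<Longrightarrow> finite (verts G)"
    and "\<And>G. G \<in> set Gs \<Longrightarrow> edges G \<subseteq> [verts G]\<^bsup>2\<^esup>"
    and "c \<in> edge_colorings (length Gs) (complete_graph m)"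
    and "\<And>i. i \<in> {1..length Gs} \<Longrightarrow>
      \<not> has_copy (Gs ! (i - 1)) (color_class (complete_graph m) c i)"
  shows "m < ramsey_number Gs"
proof (rule ccontr)
  assume "\<not> m < ramsey_number Gs"
  then have le: "ramsey_number Gs \<le> m" by simp
  have "\<exists>i \<in> {1..length Gs}.
      has_copy (Gs ! (i - 1)) (color_class (complete_graph (ramsey_number Gs)) c i)"
    using LeastI_ex[OF ex_ramsey_graphs[OF assms(1,2)]]
      edge_colorings_complete_graph_antimono[OF assms(3) le]
    unfolding ramsey_number_def by blast
  then show False
    using assms(4) has_copy_color_class_mono[OF _ le] by blast
qed

section \<open>Colourings given by symmetric matrices\<close>

text \<open>An edge is an unordered pair; \<open>Min\<close> and \<open>Max\<close> select its entry
  above the diagonal.\<close>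

definition matrix_coloring :: "'b list list \<Rightarrow> nat set \<Rightarrow> 'b" where
  "matrix_coloring M e = M ! Min e ! Max e"

definition adjacency :: "'b list list \<Rightarrow> 'b \<Rightarrow> bool list list" where
  "adjacency M k = map (map (\<lambda>a. a = k)) M"

text \<open>Vertices are represented by their adjacency rows: with a row as mask and the adjacency
  matrix as \<open>xs\<close>, the result lists the rows of the neighbours.\<close>

definition select :: "bool list \<Rightarrow> 'b list \<Rightarrow> 'b list" where
  "select bs xs = map snd (filter fst (zip bs xs))"

text \<open>On adjacency rows this is the common neighbourhood.\<close>

definition meet :: "bool list \<Rightarrow> bool list \<Rightarrow> bool list" where
  "meet = map2 (\<and>)"

text \<open>A clique is grown vertex by vertex: \<open>r\<close>, \<open>s\<close>, \<open>t\<close>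
  run through triangles, and a fourth vertex would be a common neighbour of all three.\<close>

definition K4_free :: "bool list list \<Rightarrow> bool" where
  "K4_free A \<longleftrightarrow>
     list_all (\<lambda>r. list_all (\<lambda>s. list_all (\<lambda>t. select (meet (meet r s) t) A = [])
       (select (meet r s) A)) (select r A)) A"

text \<open>The rows \<open>r\<close> and \<open>s\<close> belong to the two vertices of degree 3.
  Whether their common neighbours are adjacent is not asked, as copies need not be induced.\<close>

definition K4_minus_e_free :: "bool list list \<Rightarrow> bool" where
  "K4_minus_e_free A \<longleftrightarrow>
     list_all (\<lambda>r. list_all (\<lambda>s. length (select (meet r s) A) \<le> 1) (select r A)) A"

locale symmetric_matrix =
  fixes n :: nat and M :: "nat list list"
  assumes length_matrix: "length M = n"
    and length_row: "i < n \<Longrightarrow> length (M ! i) = n"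
    and symmetric: "i < n \<Longrightarrow> j < n \<Longrightarrow> M ! i ! j = M ! j ! i"
begin

lemma matrix_coloring_doubleton:
  assumes "i < n" "j < n"
  shows "matrix_coloring M {i, j} = M ! i ! j"
  using assms symmetric by (cases "i \<le> j") (auto simp: matrix_coloring_def min_def max_def)

lemma color_class_edge_iff:
  "{i, j} \<in> edges (color_class (complete_graph n) (matrix_coloring M) k) \<longleftrightarrow>
     i < n \<and> j < n \<and> i \<noteq> j \<and> M ! i ! j = k"
  by (auto simp: color_class_def complete_graph_def matrix_coloring_doubleton)

lemma adjacency_nth: "i < n \<Longrightarrow> j < n \<Longrightarrow> adjacency M k ! i ! j \<longleftrightarrow> M ! i ! j = k"
  by (simp add: adjacency_def length_matrix length_row)

lemma length_adjacency: "length (adjacency M k) = n"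
  by (simp add: adjacency_def length_matrix)

lemma length_adjacency_row: "i < n \<Longrightarrow> length (adjacency M k ! i) = n"
  by (simp add: adjacency_def length_matrix length_row)

end

lemma nth_mem_select: "\<lbrakk>i < length bs; i < length xs; bs ! i\<rbrakk> \<Longrightarrow> xs ! i \<in> set (select bs xs)"
  by (force simp: select_def set_zip)

text \<open>The list keeps multiplicities, so distinct vertices with equal rows are counted
  separately.\<close>

lemma length_select:
  assumes "length bs = length xs"
  shows "length (select bs xs) = card {i. i < length xs \<and> bs ! i}"
  using assms by (auto simp: select_def length_filter_conv_card intro!: arg_cong[where f = card])

lemma length_meet [simp]: "length (meet r s) = min (length r) (length s)"
  by (simp add: meet_def)

lemma meet_nth [simp]: "\<lbrakk>i < length r; i < length s\<rbrakk> \<Longrightarrow> meet r s ! i \<longleftrightarrow> r ! i \<and> s ! i"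
  by (simp add: meet_def)

context symmetric_matrix
begin

lemma no_copy_K4:
  assumes free: "K4_free (adjacency M k)"
  shows "\<not> has_copy (complete_graph 4) (color_class (complete_graph n) (matrix_coloring M) k)"
proof
  let ?A = "adjacency M k"
  assume "has_copy (complete_graph 4) (color_class (complete_graph n) (matrix_coloring M) k)"
  then obtain f where f: "\<And>e. e \<in> [{..<4::nat}]\<^bsup>2\<^esup> \<Longrightarrow>
      f ` e \<in> edges (color_class (complete_graph n) (matrix_coloring M) k)"
    unfolding has_copy_def by (auto simp: complete_graph_def)
  \<comment> \<open>The image of \<open>{i, j}\<close> is \<open>{f i, f j}\<close>, an edge of
    colour \<open>k\<close>, which is an entry of the Boolean matrix.\<close>
  have adj: "f i < n \<and> f j < n \<and> ?A ! f i ! f j" if "i < 4" "j < 4" "i \<noteq> j" for i j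
    using f[of "{i, j}"] that color_class_edge_iff[of "f i" "f j" k]
    by (auto simp: adjacency_nth)
  define r where "r = ?A ! f 0"
  define s where "s = ?A ! f 1"
  define t where "t = ?A ! f 2"
  note rows = r_def s_def t_def length_adjacency length_adjacency_row
  have "r \<in> set ?A"
    using adj[of 0 1] by (simp add: r_def length_adjacency)
  moreover have "s \<in> set (select r ?A)"
    unfolding s_def using adj[of 0 1] by (intro nth_mem_select) (simp_all add: rows)
  moreover have "t \<in> set (select (meet r s) ?A)"
    unfolding t_def using adj[of 0 1] adj[of 0 2] adj[of 1 2]
    by (intro nth_mem_select) (simp_all add: rows)
  \<comment> \<open>The fourth vertex inhabits a list that \<open>K4_free\<close> requires to be
    empty.\<close>
  moreover have "?A ! f 3 \<in> set (select (meet (meet r s) t) ?A)"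
    using adj[of 0 1] adj[of 0 3] adj[of 1 3] adj[of 2 3]
    by (intro nth_mem_select) (simp_all add: rows)
  ultimately show False
    using free unfolding K4_free_def list_all_iff by fastforce
qed

lemma no_copy_K4_minus_e:
  assumes free: "K4_minus_e_free (adjacency M k)"
  shows "\<not> has_copy K4_minus_e (color_class (complete_graph n) (matrix_coloring M) k)"
proof
  let ?A = "adjacency M k"
  assume "has_copy K4_minus_e (color_class (complete_graph n) (matrix_coloring M) k)"
  then obtain f where inj: "inj_on f {..<4::nat}"
    and f: "\<And>e. e \<in> [{..<4}]\<^bsup>2\<^esup> - {{0, 1}} \<Longrightarrow>
      f ` e \<in> edges (color_class (complete_graph n) (matrix_coloring M) k)"
    unfolding has_copy_def by (auto simp: K4_minus_e_def delete_edge_def complete_graph_def)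
  have adj: "f i < n \<and> f j < n \<and> ?A ! f i ! f j"
    if "i < 4" "j < 4" "i \<noteq> j" "{i, j} \<noteq> {0, 1}" for i j
    using f[of "{i, j}"] that color_class_edge_iff[of "f i" "f j" k]
    by (auto simp: adjacency_nth)
  \<comment> \<open>The missing edge is \<open>{0, 1}\<close>, so 2 and 3 are the vertices of degree
    3; the entries are oriented to be read from their rows.\<close>
  have adj': "f 2 < n" "f 3 < n" "f 0 < n" "f 1 < n" "?A ! f 2 ! f 3"
    "?A ! f 2 ! f 0" "?A ! f 3 ! f 0" "?A ! f 2 ! f 1" "?A ! f 3 ! f 1"
    using adj[of 2 3] adj[of 2 0] adj[of 3 0] adj[of 2 1] adj[of 3 1]
    by (auto simp: doubleton_eq_iff)
  define r where "r = ?A ! f 2"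
  define s where "s = ?A ! f 3"
  note rows = r_def s_def length_adjacency length_adjacency_row
  have "r \<in> set ?A"
    using adj' by (simp add: r_def length_adjacency)
  moreover have "s \<in> set (select r ?A)"
    unfolding s_def using adj' by (intro nth_mem_select) (simp_all add: rows)
  ultimately have "length (select (meet r s) ?A) \<le> 1"
    using free unfolding K4_minus_e_free_def list_all_iff by blast
  \<comment> \<open>No edge joins 0 and 1, so their images are separated by injectivity of
    \<open>f\<close>. They are two common neighbours of \<open>f 2\<close> and
    \<open>f 3\<close>.\<close>
  moreover have "f 0 \<noteq> f 1"
    using inj by (simp add: inj_on_eq_iff)
  then have "card {f 0, f 1} = 2" by simp
  moreover have "card {f 0, f 1} \<le> card {i. i < n \<and> meet r s ! i}"
    using adj' by (intro card_mono) (auto simp: rows)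
  moreover have "card {i. i < n \<and> meet r s ! i} = length (select (meet r s) ?A)"
    using adj' by (simp add: length_select rows)
  ultimately show False by simp
qed

end

section \<open>The colouring of the complete graph on 34 vertices\<close>

text \<open>The 8 by 8 blocks are circulant, and the last two rows and columns alternate on each
  block. The diagonal holds 0, which is no colour, so no vertex becomes its own neighbour.\<close>

definition color_matrix :: "nat list list" where
  "color_matrix = [
    [0,1,1,3,3,3,1,1,3,1,3,2,2,2,2,1,2,3,1,2,2,2,2,3,3,3,1,1,2,1,1,3,1,3],
    [1,0,1,1,3,3,3,1,1,3,1,3,2,2,2,2,3,2,3,1,2,2,2,2,3,3,3,1,1,2,1,1,3,1],
    [1,1,0,1,1,3,3,3,2,1,3,1,3,2,2,2,2,3,2,3,1,2,2,2,1,3,3,3,1,1,2,1,1,3],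
    [3,1,1,0,1,1,3,3,2,2,1,3,1,3,2,2,2,2,3,2,3,1,2,2,1,1,3,3,3,1,1,2,3,1],
    [3,3,1,1,0,1,1,3,2,2,2,1,3,1,3,2,2,2,2,3,2,3,1,2,2,1,1,3,3,3,1,1,1,3],
    [3,3,3,1,1,0,1,1,2,2,2,2,1,3,1,3,2,2,2,2,3,2,3,1,1,2,1,1,3,3,3,1,3,1],
    [1,3,3,3,1,1,0,1,3,2,2,2,2,1,3,1,1,2,2,2,2,3,2,3,1,1,2,1,1,3,3,3,1,3],
    [1,1,3,3,3,1,1,0,1,3,2,2,2,2,1,3,3,1,2,2,2,2,3,2,3,1,1,2,1,1,3,3,3,1],
    [3,1,2,2,2,2,3,1,0,3,1,2,2,2,1,3,3,1,1,3,2,3,1,1,3,1,3,2,3,2,1,1,1,2],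
    [1,3,1,2,2,2,2,3,3,0,3,1,2,2,2,1,1,3,1,1,3,2,3,1,1,3,1,3,2,3,2,1,2,1],
    [3,1,3,1,2,2,2,2,1,3,0,3,1,2,2,2,1,1,3,1,1,3,2,3,1,1,3,1,3,2,3,2,1,2],
    [2,3,1,3,1,2,2,2,2,1,3,0,3,1,2,2,3,1,1,3,1,1,3,2,2,1,1,3,1,3,2,3,2,1],
    [2,2,3,1,3,1,2,2,2,2,1,3,0,3,1,2,2,3,1,1,3,1,1,3,3,2,1,1,3,1,3,2,1,2],
    [2,2,2,3,1,3,1,2,2,2,2,1,3,0,3,1,3,2,3,1,1,3,1,1,2,3,2,1,1,3,1,3,2,1],
    [2,2,2,2,3,1,3,1,1,2,2,2,1,3,0,3,1,3,2,3,1,1,3,1,3,2,3,2,1,1,3,1,1,2],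
    [1,2,2,2,2,3,1,3,3,1,2,2,2,1,3,0,1,1,3,2,3,1,1,3,1,3,2,3,2,1,1,3,2,1],
    [2,3,2,2,2,2,1,3,3,1,1,3,2,3,1,1,0,3,1,1,3,1,1,3,2,1,2,2,3,2,3,1,1,3],
    [3,2,3,2,2,2,2,1,1,3,1,1,3,2,3,1,3,0,3,1,1,3,1,1,1,2,1,2,2,3,2,3,3,1],
    [1,3,2,3,2,2,2,2,1,1,3,1,1,3,2,3,1,3,0,3,1,1,3,1,3,1,2,1,2,2,3,2,1,3],
    [2,1,3,2,3,2,2,2,3,1,1,3,1,1,3,2,1,1,3,0,3,1,1,3,2,3,1,2,1,2,2,3,3,1],
    [2,2,1,3,2,3,2,2,2,3,1,1,3,1,1,3,3,1,1,3,0,3,1,1,3,2,3,1,2,1,2,2,1,3],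
    [2,2,2,1,3,2,3,2,3,2,3,1,1,3,1,1,1,3,1,1,3,0,3,1,2,3,2,3,1,2,1,2,3,1],
    [2,2,2,2,1,3,2,3,1,3,2,3,1,1,3,1,1,1,3,1,1,3,0,3,2,2,3,2,3,1,2,1,1,3],
    [3,2,2,2,2,1,3,2,1,1,3,2,3,1,1,3,3,1,1,3,1,1,3,0,1,2,2,3,2,3,1,2,3,1],
    [3,3,1,1,2,1,1,3,3,1,1,2,3,2,3,1,2,1,3,2,3,2,2,1,0,2,1,3,2,3,1,2,1,2],
    [3,3,3,1,1,2,1,1,1,3,1,1,2,3,2,3,1,2,1,3,2,3,2,2,2,0,2,1,3,2,3,1,2,1],
    [1,3,3,3,1,1,2,1,3,1,3,1,1,2,3,2,2,1,2,1,3,2,3,2,1,2,0,2,1,3,2,3,1,2],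
    [1,1,3,3,3,1,1,2,2,3,1,3,1,1,2,3,2,2,1,2,1,3,2,3,3,1,2,0,2,1,3,2,2,1],
    [2,1,1,3,3,3,1,1,3,2,3,1,3,1,1,2,3,2,2,1,2,1,3,2,2,3,1,2,0,2,1,3,1,2],
    [1,2,1,1,3,3,3,1,2,3,2,3,1,3,1,1,2,3,2,2,1,2,1,3,3,2,3,1,2,0,2,1,2,1],
    [1,1,2,1,1,3,3,3,1,2,3,2,3,1,3,1,3,2,3,2,2,1,2,1,1,3,2,3,1,2,0,2,1,2],
    [3,1,1,2,1,1,3,3,1,1,2,3,2,3,1,3,1,3,2,3,2,2,1,2,2,1,3,2,3,1,2,0,2,1],
    [1,3,1,3,1,3,1,3,1,2,1,2,1,2,1,2,1,3,1,3,1,3,1,3,1,2,1,2,1,2,1,2,0,2],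
    [3,1,3,1,3,1,3,1,2,1,2,1,2,1,2,1,3,1,3,1,3,1,3,1,2,1,2,1,2,1,2,1,2,0]]"

text \<open>Symmetry as one equation of lists, decided by evaluation; indexing it gives the
  entrywise form.\<close>

lemma color_matrix_transpose:
  "color_matrix = map (\<lambda>i. map (\<lambda>r. r ! i) color_matrix) [0..<34]"
  by code_simp

lemma color_matrix_lengths:
  "length color_matrix = 34" "list_all (\<lambda>r. length r = 34) color_matrix"
  by code_simp+

lemma color_matrix_entries:
  "list_all (\<lambda>i. list_all (\<lambda>j. i = j \<or> color_matrix ! i ! j \<in> {1, 2, 3}) [0..<34]) [0..<34]"
  by code_simp

lemma color_matrix_free:
  "K4_free (adjacency color_matrix 1)"
  "K4_minus_e_free (adjacency color_matrix 2)"
  "K4_minus_e_free (adjacency color_matrix 3)"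
  by code_simp+

interpretation color_matrix: symmetric_matrix 34 color_matrix
proof
  show "length color_matrix = 34"
    by (fact color_matrix_lengths)
  show "length (color_matrix ! i) = 34" if "i < 34" for i
    using that color_matrix_lengths by (auto simp: list_all_length)
  show "color_matrix ! i ! j = color_matrix ! j ! i" if "i < 34" "j < 34" for i j
  proof -
    have "color_matrix ! i ! j = map (\<lambda>i. map (\<lambda>r. r ! i) color_matrix) [0..<34] ! i ! j"
      using color_matrix_transpose by simp
    then show ?thesis
      using that color_matrix_lengths(1) by simp
  qed
qed

lemma color_matrix_coloring:
  "matrix_coloring color_matrix \<in> edge_colorings 3 (complete_graph 34)"
proof -
  have "color_matrix ! i ! j \<in> {1..3}" if "i < 34" "j < 34" "i \<noteq> j" for i j
    using color_matrix_entries that by (fastforce simp: list_all_iff)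
  then have "matrix_coloring color_matrix e \<in> {1..3}" if "e \<in> [{..<34}]\<^bsup>2\<^esup>" for e
    using that color_matrix.matrix_coloring_doubleton by (auto elim!: nsets2_E simp del: atLeastAtMost_iff)
  then show ?thesis
    by (auto simp: edge_colorings_def complete_graph_def)
qed

theorem theorem1:
  "ramsey_number [complete_graph 4, K4_minus_e, K4_minus_e] \<ge> 35 \<and>
   (\<exists>c \<in> edge_colorings 3 (complete_graph 34).
      \<not> has_copy (complete_graph 4) (color_class (complete_graph 34) c 1) \<and>
      \<not> has_copy K4_minus_e (color_class (complete_graph 34) c 2) \<and>
      \<not> has_copy K4_minus_e (color_class (complete_graph 34) c 3))"
proof -
  let ?c = "matrix_coloring color_matrix"
  let ?Gs = "[complete_graph 4, K4_minus_e, K4_minus_e]"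
  have no_copy:
    "\<not> has_copy (complete_graph 4) (color_class (complete_graph 34) ?c 1)"
    "\<not> has_copy K4_minus_e (color_class (complete_graph 34) ?c 2)"
    "\<not> has_copy K4_minus_e (color_class (complete_graph 34) ?c 3)"
    using color_matrix_free color_matrix.no_copy_K4 color_matrix.no_copy_K4_minus_e by blast+
  have "34 < ramsey_number ?Gs"
  proof (rule ramsey_number_gt)
    show "?c \<in> edge_colorings (length ?Gs) (complete_graph 34)"
      using color_matrix_coloring by (simp add: numeral_3_eq_3)
    show "\<not> has_copy (?Gs ! (i - 1)) (color_class (complete_graph 34) ?c i)"
      if "i \<in> {1..length ?Gs}" for i
    proof -
      have "i = 1 \<or> i = 2 \<or> i = 3"
        using that by auto
      then show ?thesis
        using no_copy by auto
    qed
  \<comment> \<open>What remains is that the three forbidden graphs are finite with two-element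
    edges.\<close>
  qed (auto simp: K4_minus_e_def delete_edge_def complete_graph_def)
  then show ?thesis
    using no_copy color_matrix_coloring by auto
qed

end
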